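(* Let $G=G_{n,1/2}$ and let $Y_n$ be the number of unordered partitions of $V(G)$ into two sets $\{A,B\}$ such that one of $G[A],G[B]$ has all degrees even and the other has all degrees odd. If $n$ is odd, then for $0\le k\le n-1$, $$\Pr(Y_n=2^k)=2^{-\binom n2}\prod_{i=1}^{\lfloor (n-1-k)/2\rfloor}(1-2^{-2i})^{-1}\prod_{i=k+1}^{n-1}(2^i-1),$$ and $\Pr(Y_n=x)=0$ if $x\neq 2^k$ for every such $k$. If $n$ is even, then $\Pr(Y_n=x)=\Pr(Y_{n-1}=x)$ for all $x$.
   Context: $G_{n,1/2}$ is the binomial random graph on vertex set $[n]$ with each edge present independently with probability $1/2$. Empty products equal $1$. *)

theory Defs
  imports "HOL-Probability.Probability"
begin

text \<open>
  A simple graph on a vertex set \<open>V\<close> is given by its edge set, a subset of \<open>vertex_pairs V\<close>.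
\<close>

definition vertex_pairs :: "'a set \<Rightarrow> 'a set set" where
  "vertex_pairs V = {e. e \<subseteq> V \<and> card e = 2}"

definition induced_edges :: "'a set set \<Rightarrow> 'a set \<Rightarrow> 'a set set" where
  "induced_edges E A = {e \<in> E. e \<subseteq> A}"

definition vertex_degree :: "'a set set \<Rightarrow> 'a \<Rightarrow> nat" where
  "vertex_degree E v = card {e \<in> E. v \<in> e}"

definition induces_all_even :: "'a set set \<Rightarrow> 'a set \<Rightarrow> bool" where
  "induces_all_even E A \<longleftrightarrow> (\<forall>v\<in>A. even (vertex_degree (induced_edges E A) v))"

definition induces_all_odd :: "'a set set \<Rightarrow> 'a set \<Rightarrow> bool" where
  "induces_all_odd E A \<longleftrightarrow> (\<forall>v\<in>A. odd (vertex_degree (induced_edges E A) v))"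

text \<open>
  An unordered partition of \<open>V\<close> into two sets is the set \<open>{A, B}\<close>. One of the two sets may be
  empty, and the empty graph has, vacuously, all degrees even as well as all degrees odd.
\<close>

definition even_odd_partitions :: "'a set \<Rightarrow> 'a set set \<Rightarrow> 'a set set set" where
  "even_odd_partitions V E =
     {{A, B} | A B. A \<union> B = V \<and> A \<inter> B = {} \<and>
        (induces_all_even E A \<and> induces_all_odd E B \<or>
         induces_all_odd E A \<and> induces_all_even E B)}"

text \<open>The binomial random graph on \<open>{1..n}\<close> with edge probability \<open>p\<close>.\<close>

definition binomial_random_graph :: "nat \<Rightarrow> real \<Rightarrow> nat set set pmf" where
  "binomial_random_graph n p =
     map_pmf (\<lambda>f. {e \<in> vertex_pairs {1..n}. f e})
       (Pi_pmf (vertex_pairs {1..n}) False (\<lambda>_. bernoulli_pmf p))"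

definition Y :: "nat \<Rightarrow> nat set set \<Rightarrow> nat" where
  "Y n E = card (even_odd_partitions {1..n} E)"

definition prob_Y_eq :: "nat \<Rightarrow> nat \<Rightarrow> real" where
  "prob_Y_eq n x = measure_pmf.prob (binomial_random_graph n (1/2)) {E. Y n E = x}"

end

theory Submission
  imports Defs "HOL-Library.Z2" "HOL-Library.Function_Algebras"
begin

text \<open>
  Let \<open>M\<close> be the adjacency matrix of the graph over \<open>GF(2)\<close> with diagonal entries \<open>1 + deg v\<close>. The
  indicator vector \<open>x\<close> of \<open>A\<close> satisfies \<open>M x = diag M\<close> iff \<open>A\<close> induces even and \<open>V - A\<close> induces odd
  degrees. The range of a symmetric matrix is the orthogonal complement of its kernel and contains
  its diagonal, so \<open>Y\<close> equals the cardinality of \<open>ker M\<close>. The graphs correspond to the symmetric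
  matrices with \<open>M 1 = 1\<close>. For odd \<open>n\<close>, \<open>1\<close> is complemented by \<open>1\<^sup>\<bottom>\<close>, on which \<open>M\<close> is an arbitrary
  symmetric form in dimension \<open>n - 1\<close>; for even \<open>n\<close>, deleting a vertex and
  switching the rest along its neighbourhood (complementing the result if its degree is odd) preserves the nullity.
  The nullity distribution of symmetric matrices follows by adding one row and column \<open>(v, c)\<close> to
  \<open>S\<close>: the nullity drops by one if \<open>v\<close> is not in the range of \<open>S\<close>; otherwise one value of \<open>c\<close>
  raises it by one and the other preserves it.
\<close>

subsection \<open>Linear algebra over the field with two elements\<close>

text \<open>Keeps \<open>+\<close> and \<open>*\<close> on \<open>bit\<close> as field operations,
  so that the ring and sum lemmas stay applicable instead of terms turning into bit
  operations.\<close>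

declare add_bit_eq_xor [simp del] mult_bit_eq_and [simp del]

lemma bit_add_self [simp]: "a + a = 0" "a + (a + b) = b" for a b :: bit
  by (cases a; cases b; simp)+

lemma bit_mult_self [simp]: "a * a = a" for a :: bit
  by (cases a) simp_all

lemma bit_add_eq_0_iff: "a + b = 0 \<longleftrightarrow> a = b" for a b :: bit
  by (cases a; cases b; simp)

lemma bit_fun_add_self [simp]: "x + x = 0" "x + (x + y) = y" for x y :: "'a \<Rightarrow> bit"
  by (simp_all add: fun_eq_iff)

text \<open>Vectors over \<open>I\<close> are total functions that vanish off \<open>I\<close>. Thus
  vectors over different index sets share one type, and equality of vectors is equality of
  functions.\<close>

definition vecs :: "'a set \<Rightarrow> ('a \<Rightarrow> bit) set" where
  "vecs I = {x. \<forall>i. i \<notin> I \<longrightarrow> x i = 0}"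

definition dot :: "'a set \<Rightarrow> ('a \<Rightarrow> bit) \<Rightarrow> ('a \<Rightarrow> bit) \<Rightarrow> bit" where
  "dot I x y = (\<Sum>i\<in>I. x i * y i)"

definition mat_vec :: "'a set \<Rightarrow> ('a \<Rightarrow> 'a \<Rightarrow> bit) \<Rightarrow> ('a \<Rightarrow> bit) \<Rightarrow> 'a \<Rightarrow> bit" where
  "mat_vec I S x i = (if i \<in> I then dot I (S i) x else 0)"

definition mat_ker :: "'a set \<Rightarrow> ('a \<Rightarrow> 'a \<Rightarrow> bit) \<Rightarrow> ('a \<Rightarrow> bit) set" where
  "mat_ker I S = {x \<in> vecs I. mat_vec I S x = 0}"

definition sym_mats :: "'a set \<Rightarrow> ('a \<Rightarrow> 'a \<Rightarrow> bit) set" where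
  "sym_mats I = {S. (\<forall>i j. S i j = S j i) \<and> (\<forall>i j. i \<notin> I \<longrightarrow> S i j = 0)}"

definition subspace_bit :: "('a \<Rightarrow> bit) set \<Rightarrow> bool" where
  "subspace_bit W \<longleftrightarrow> 0 \<in> W \<and> (\<forall>x\<in>W. \<forall>y\<in>W. x + y \<in> W)"

lemma finite_vecs [simp]: "finite I \<Longrightarrow> finite (vecs I)"
  and card_vecs: "finite I \<Longrightarrow> card (vecs I) = 2 ^ card I"
proof -
  assume fin: "finite I"
  have bij: "bij_betw (\<lambda>x. {i. x i = 1}) (vecs I) (Pow I)"
    by (rule bij_betwI[where g = "\<lambda>A i. of_bool (i \<in> A)"])
       (auto simp: vecs_def fun_eq_iff of_bool_def)
  show "finite (vecs I)" using bij_betw_finite[OF bij] fin by simp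
  show "card (vecs I) = 2 ^ card I"
    using bij_betw_same_card[OF bij] fin by (simp add: card_Pow)
qed

lemma subspace_vecs: "subspace_bit (vecs I)"
  by (auto simp: subspace_bit_def vecs_def)

lemma dot_add_left: "dot I (x + y) z = dot I x z + dot I y z"
  and dot_add_right: "dot I z (x + y) = dot I z x + dot I z y"
  by (simp_all add: dot_def sum.distrib algebra_simps)

lemma dot_0 [simp]: "dot I 0 x = 0" "dot I x 0 = 0"
  by (simp_all add: dot_def)

lemma dot_commute: "dot I x y = dot I y x"
  by (simp add: dot_def mult.commute)

lemma dot_insert:
  assumes "finite I" "a \<notin> I"
  shows "dot (insert a I) x y = x a * y a + dot I x y"
  using assms by (simp add: dot_def)

lemma dot_cong: "(\<And>i. i \<in> I \<Longrightarrow> x i = x' i) \<Longrightarrow> (\<And>i. i \<in> I \<Longrightarrow> y i = y' i) \<Longrightarrow> dot I x y = dot I x' y'"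
  by (simp add: dot_def)

lemma dot_unit:
  assumes "finite I" "i \<in> I"
  shows "dot I (\<lambda>j. of_bool (j = i)) x = x i"
  using assms by (simp add: dot_def of_bool_def if_distrib[where f = "\<lambda>u. u * _"] cong: if_cong)

lemma mat_vec_add: "mat_vec I S (x + y) = mat_vec I S x + mat_vec I S y"
  by (auto simp: mat_vec_def fun_eq_iff dot_add_right)

lemma mat_vec_0 [simp]: "mat_vec I S 0 = 0"
  by (auto simp: mat_vec_def fun_eq_iff)

lemma mat_vec_in_vecs [simp]: "mat_vec I S x \<in> vecs I"
  by (auto simp: mat_vec_def vecs_def)

lemma subspace_mat_ker: "subspace_bit (mat_ker I S)"
  using subspace_vecs[of I] by (auto simp: mat_ker_def subspace_bit_def mat_vec_add)

lemma finite_mat_ker [simp]: "finite I \<Longrightarrow> finite (mat_ker I S)"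
  by (simp add: mat_ker_def)

lemma card_mat_ker_pos: "finite I \<Longrightarrow> card (mat_ker I S) > 0"
  using subspace_mat_ker[of I S] by (auto simp: card_gt_0_iff subspace_bit_def)

text \<open>Translation by \<open>w\<close> exchanges the fibres of \<open>g\<close> over
  \<open>0\<close> and \<open>1\<close>, so the two have equal size.\<close>

lemma card_zeros_of_functional:
  assumes W: "subspace_bit W" and "finite W"
    and add: "\<And>x y. x \<in> W \<Longrightarrow> y \<in> W \<Longrightarrow> g (x + y) = g x + g y"
    and w: "w \<in> W" "g w = (1::bit)"
  shows "card W = 2 * card {x \<in> W. g x = 0}"
proof -
  have "bij_betw (\<lambda>x. x + w) {x \<in> W. g x = 0} {x \<in> W. g x = 1}"
    by (rule bij_betwI[where g = "\<lambda>x. x + w"])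
       (use W w in \<open>auto simp: add subspace_bit_def add.assoc\<close>)
  then have "card {x \<in> W. g x = 1} = card {x \<in> W. g x = 0}"
    by (simp add: bij_betw_same_card)
  moreover have "W = {x \<in> W. g x = 0} \<union> {x \<in> W. g x = 1}" using bit_not_zero_iff by blast
  moreover have "card ({x \<in> W. g x = 0} \<union> {x \<in> W. g x = 1}) = card {x \<in> W. g x = 0} + card {x \<in> W. g x = 1}"
    using \<open>finite W\<close> by (intro card_Un_disjoint) auto
  ultimately show ?thesis by simp
qed

text \<open>A nonempty fibre of a linear map is a coset of its kernel.\<close>

lemma card_fiber_mat_vec:
  assumes "v \<in> mat_vec I S ` vecs I"
  shows "card {x \<in> vecs I. mat_vec I S x = v} = card (mat_ker I S)"
proof -
  obtain u where u: "u \<in> vecs I" "mat_vec I S u = v" using assms by auto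
  have "bij_betw (\<lambda>x. x + u) (mat_ker I S) {x \<in> vecs I. mat_vec I S x = v}"
    by (rule bij_betwI[where g = "\<lambda>x. x + u"])
       (use u subspace_vecs[of I] in \<open>auto simp: mat_ker_def mat_vec_add subspace_bit_def add.assoc\<close>)
  then show ?thesis by (simp add: bij_betw_same_card)
qed

text \<open>Rank-nullity in multiplicative form, which avoids any notion of dimension:
  \<open>vecs I\<close> is the union of the fibres, all of the same size.\<close>

lemma card_mat_range:
  assumes "finite I"
  shows "card (mat_vec I S ` vecs I) * card (mat_ker I S) = 2 ^ card I"
proof -
  have "2 ^ card I = (\<Sum>x\<in>vecs I. 1::nat)" using assms by (simp add: card_vecs)
  also have "\<dots> = (\<Sum>v\<in>mat_vec I S ` vecs I. \<Sum>x\<in>{x \<in> vecs I. mat_vec I S x = v}. 1)"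
    using assms by (intro sum.image_gen) simp
  also have "\<dots> = (\<Sum>v\<in>mat_vec I S ` vecs I. card (mat_ker I S))"
    by (intro sum.cong refl) (simp add: card_fiber_mat_vec)
  finally show ?thesis by simp
qed

text \<open>Double counting of the pairs \<open>(w, v)\<close> with \<open>w \<bullet> v = 0\<close>: a nonzero functional vanishes on
  exactly half of a space.\<close>

lemma card_orthogonal:
  assumes fin: "finite I" and W: "subspace_bit W" and sub: "W \<subseteq> vecs I"
  shows "card {v \<in> vecs I. \<forall>w\<in>W. dot I w v = 0} * card W = 2 ^ card I"
proof -
  let ?V = "vecs I" and ?O = "{v \<in> vecs I. \<forall>w\<in>W. dot I w v = 0}"
  have finW: "finite W" using sub fin finite_subset finite_vecs by blast
  have 0: "0 \<in> W" using W by (simp add: subspace_bit_def)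
  \<comment> \<open>Both ways of counting are doubled to avoid halves. The surplus term records the
    vectors whose functional is identically zero.\<close>
  have A: "2 * card {w \<in> W. dot I w v = 0} = card W + (if v \<in> ?O then card W else 0)" if v: "v \<in> ?V" for v
  proof (cases "v \<in> ?O")
    case True
    then have "{w \<in> W. dot I w v = 0} = W" by auto
    then show ?thesis using True by simp
  next
    case False
    then obtain w where "w \<in> W" "dot I w v = 1" using v by auto
    from card_zeros_of_functional[of W "\<lambda>w. dot I w v", OF W finW _ this]
    have "card W = 2 * card {w \<in> W. dot I w v = 0}" by (simp add: dot_add_left)
    then show ?thesis by (simp only: False if_False add_0_right)
  qed
  have B: "2 * card {v \<in> ?V. dot I w v = 0} = card ?V + (if w = 0 then card ?V else 0)" if "w \<in> W" for w
  proof (cases "w = 0")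
    case True
    then show ?thesis by simp
  next
    case False
    then obtain i where i: "w i = 1" by (auto simp: fun_eq_iff)
    then have "i \<in> I" using that sub by (force simp: vecs_def)
    then have "(\<lambda>j. of_bool (j = i)) \<in> ?V" "dot I w (\<lambda>j. of_bool (j = i)) = 1"
      using i dot_unit[OF fin \<open>i \<in> I\<close>, of w] by (auto simp: vecs_def dot_commute)
    from card_zeros_of_functional[of ?V "dot I w", OF subspace_vecs _ _ this] fin
    show ?thesis using False by (simp add: dot_add_right)
  qed
  have "(\<Sum>v\<in>?V. card {w \<in> W. dot I w v = 0}) = (\<Sum>w\<in>W. card {v \<in> ?V. dot I w v = 0})"
    using fin finW by (intro sum_multicount_gen) auto
  then have "(\<Sum>v\<in>?V. 2 * card {w \<in> W. dot I w v = 0}) = (\<Sum>w\<in>W. 2 * card {v \<in> ?V. dot I w v = 0})"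
    by (simp flip: sum_distrib_left)
  then have "(\<Sum>v\<in>?V. card W + (if v \<in> ?O then card W else 0))
      = (\<Sum>w\<in>W. card ?V + (if w = 0 then card ?V else 0))"
    using A B by (simp cong: sum.cong)
  moreover have "(\<Sum>v\<in>?V. (if v \<in> ?O then card W else 0)) = card ?O * card W"
    using fin by (subst sum.inter_restrict[symmetric]) (auto simp: Int_def)
  ultimately have "card ?V * card W + card ?O * card W = card W * card ?V + card ?V"
    using 0 finW by (simp add: sum.distrib)
  then show ?thesis using fin by (simp add: card_vecs)
qed

section \<open>Range, kernel and diagonal of a symmetric matrix\<close>

lemma sym_mats_sym: "S \<in> sym_mats I \<Longrightarrow> S i j = S j i"
  and sym_mats_outside: "S \<in> sym_mats I \<Longrightarrow> i \<notin> I \<or> j \<notin> I \<Longrightarrow> S i j = 0"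
  by (auto simp: sym_mats_def)

lemma dot_mat_vec_sym:
  assumes "S \<in> sym_mats I"
  shows "dot I x (mat_vec I S y) = dot I (mat_vec I S x) y"
proof -
  have "dot I x (mat_vec I S y) = (\<Sum>i\<in>I. \<Sum>j\<in>I. x i * (S i j * y j))"
    by (simp add: dot_def mat_vec_def sum_distrib_left cong: sum.cong)
  also have "\<dots> = (\<Sum>j\<in>I. \<Sum>i\<in>I. x i * (S i j * y j))" by (rule sum.swap)
  also have "\<dots> = (\<Sum>j\<in>I. \<Sum>i\<in>I. S j i * x i * y j)"
    using sym_mats_sym[OF assms] by (simp add: algebra_simps)
  also have "\<dots> = dot I (mat_vec I S x) y"
    by (simp add: dot_def mat_vec_def sum_distrib_right cong: sum.cong)
  finally show ?thesis .
qed

text \<open>Symmetry gives the inclusion from left to right. Equality follows since either side,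
  multiplied by the size of the kernel, has cardinality \<open>2 ^ card I\<close>.\<close>

lemma mat_range_eq_orthogonal_ker:
  assumes fin: "finite I" and S: "S \<in> sym_mats I"
  shows "mat_vec I S ` vecs I = {v \<in> vecs I. \<forall>w\<in>mat_ker I S. dot I w v = 0}" (is "?R = ?O")
proof (rule card_subset_eq)
  show "finite ?O" using fin by simp
  show "?R \<subseteq> ?O" by (auto simp: dot_mat_vec_sym[OF S] mat_ker_def)
  have "card ?R * card (mat_ker I S) = card ?O * card (mat_ker I S)"
    using card_mat_range[OF fin, of S] card_orthogonal[OF fin subspace_mat_ker[of I S]]
    by (simp add: mat_ker_def)
  then show "card ?R = card ?O" using card_mat_ker_pos[OF fin, of S] by simp
qed

text \<open>In characteristic 2 the off-diagonal terms of a symmetric quadratic form cancel in pairs.\<close>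

lemma dot_mat_vec_self:
  assumes "finite I" "\<And>i j. S i j = S j i"
  shows "dot I x (mat_vec I S x) = dot I x (\<lambda>i. S i i)"
proof -
  have "(\<Sum>i\<in>I. \<Sum>j\<in>I. x i * (S i j * x j)) = (\<Sum>i\<in>I. x i * S i i)"
    using \<open>finite I\<close>
  proof (induction I)
    case (insert a I)
    have "(\<Sum>i\<in>I. x i * (S i a * x a)) = (\<Sum>j\<in>I. x a * (S a j * x j))"
      using assms(2)[of a] by (intro sum.cong) (auto simp: algebra_simps)
    then show ?case using insert by (simp add: sum.distrib add.assoc add.left_commute mult.commute[of "x a"] mult.assoc)
  qed simp
  then show ?thesis
    by (simp add: dot_def mat_vec_def sum_distrib_left cong: sum.cong)
qed

text \<open>For \<open>w\<close> in the kernel, the product of \<open>w\<close> with the diagonal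
  equals that of \<open>w\<close> with \<open>S w\<close>, which is \<open>0\<close>; so the
  diagonal is orthogonal to the kernel.\<close>

lemma diagonal_in_mat_range:
  assumes fin: "finite I" and S: "S \<in> sym_mats I"
  shows "(\<lambda>i. S i i) \<in> mat_vec I S ` vecs I"
  unfolding mat_range_eq_orthogonal_ker[OF assms]
proof (intro CollectI conjI ballI)
  show "(\<lambda>i. S i i) \<in> vecs I" using S by (auto simp: vecs_def sym_mats_def)
  fix w assume "w \<in> mat_ker I S"
  then show "dot I w (\<lambda>i. S i i) = 0"
    using dot_mat_vec_self[OF fin, of S w] sym_mats_sym[OF S] by (simp add: mat_ker_def)
qed

subsection \<open>Counting symmetric matrices by nullity\<close>

lemma bij_betw_restrict:
  assumes "bij_betw f A B"
  shows "bij_betw f {x \<in> A. P (f x)} {y \<in> B. P y}"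
  by (rule bij_betw_subset[OF assms]) (use bij_betw_imp_surj_on[OF assms] in blast)+

section \<open>Kernels of bordered symmetric matrices\<close>

definition border :: "'a \<Rightarrow> ('a \<Rightarrow> 'a \<Rightarrow> bit) \<Rightarrow> ('a \<Rightarrow> bit) \<Rightarrow> bit \<Rightarrow> 'a \<Rightarrow> 'a \<Rightarrow> bit" where
  "border a S v c i j = (if i = a then if j = a then c else v j else if j = a then v i else S i j)"

lemma bij_betw_border:
  assumes "a \<notin> I"
  shows "bij_betw (\<lambda>(S, v, c). border a S v c) (sym_mats I \<times> vecs I \<times> UNIV) (sym_mats (insert a I))"
  by (rule bij_betwI[where g = "\<lambda>M. (\<lambda>i j. if i = a \<or> j = a then 0 else M i j, \<lambda>i. if i = a then 0 else M a i, M a a)"])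
     (use assms in \<open>auto simp: border_def sym_mats_def vecs_def fun_eq_iff\<close>)

lemma sym_mats_empty: "sym_mats {} = {0}"
  by (auto simp: sym_mats_def fun_eq_iff)

lemma UNIV_bit: "UNIV = {0, 1::bit}"
  using bit_not_zero_iff by blast

lemma finite_UNIV_bit [simp]: "finite (UNIV :: bit set)" "finite (A :: bit set)"
  by (auto simp: UNIV_bit intro: finite_subset[OF subset_UNIV])

lemma finite_sym_mats [simp]: "finite I \<Longrightarrow> finite (sym_mats I)"
proof (induction I rule: finite_induct)
  case (insert a I)
  then show ?case using bij_betw_finite[OF bij_betw_border[OF insert.hyps(2)]] by simp
qed (simp add: sym_mats_empty)

lemma dot_border:
  assumes "finite I" "a \<notin> I" "i \<in> insert a I"
  shows "dot (insert a I) (border a S v c i) y =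
    (if i = a then c * y a + dot I v y else v i * y a + dot I (S i) y)"
proof -
  have "dot I (border a S v c i) y = dot I (if i = a then v else S i) y"
    using assms by (intro dot_cong) (auto simp: border_def)
  then show ?thesis using assms by (simp add: dot_insert border_def)
qed

lemma mat_vec_eq_iff:
  "v \<in> vecs I \<Longrightarrow> mat_vec I S x = v \<longleftrightarrow> (\<forall>i\<in>I. dot I (S i) x = v i)"
  by (auto simp: fun_eq_iff mat_vec_def vecs_def)

lemma mat_ker_iff: "x \<in> mat_ker I S \<longleftrightarrow> x \<in> vecs I \<and> (\<forall>i\<in>I. dot I (S i) x = 0)"
  using mat_vec_eq_iff[of 0 I S x] by (auto simp: mat_ker_def vecs_def)

text \<open>The kernel is split by the \<open>a\<close>-coordinate. Coordinate \<open>0\<close>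
  leaves the kernel vectors of \<open>S\<close> orthogonal to \<open>v\<close>. Coordinate
  \<open>1\<close> leaves the solutions of \<open>S x = v\<close> with \<open>v\<close> times
  \<open>x\<close> equal to \<open>c\<close>, no signs occurring in characteristic 2.\<close>

lemma card_mat_ker_border:
  assumes fin: "finite I" and a: "a \<notin> I" and v: "v \<in> vecs I"
  shows "card (mat_ker (insert a I) (border a S v c)) =
    card {x \<in> mat_ker I S. dot I v x = 0} + card {x \<in> vecs I. mat_vec I S x = v \<and> dot I v x = c}"
proof -
  let ?A = "{x \<in> mat_ker I S. dot I v x = 0}"
  let ?B = "{x \<in> vecs I. mat_vec I S x = v \<and> dot I v x = c}"
  let ?K = "mat_ker (insert a I) (border a S v c)"
  have K: "y \<in> ?K \<longleftrightarrow> y \<in> vecs (insert a I) \<and> (\<forall>i\<in>I. v i * y a + dot I (S i) y = 0) \<and> c * y a + dot I v y = 0" for y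
  proof -
    have "dot (insert a I) (border a S v c i) y = v i * y a + dot I (S i) y" if "i \<in> I" for i
      using that a dot_border[OF fin a, of i S v c y] by auto
    moreover have "dot (insert a I) (border a S v c a) y = c * y a + dot I v y"
      using dot_border[OF fin a, of a S v c y] by simp
    ultimately show ?thesis by (auto simp: mat_ker_iff)
  qed
  have upd: "dot I w (x(a := t)) = dot I w x" for w x t
    using a by (intro dot_cong) auto
  have "{y \<in> ?K. y a = 0} = ?A"
    unfolding mat_ker_iff[of _ I] using a by (auto simp: K vecs_def)
  moreover have "bij_betw (\<lambda>x. x(a := 1)) ?B {y \<in> ?K. y a = 1}"
  proof (rule bij_betwI[where g = "\<lambda>y. y(a := 0)"])
    show "(\<lambda>x. x(a := 1)) \<in> ?B \<rightarrow> {y \<in> ?K. y a = 1}"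
      using a v by (auto simp: K upd mat_vec_eq_iff vecs_def)
    show "(\<lambda>y. y(a := 0)) \<in> {y \<in> ?K. y a = 1} \<rightarrow> ?B"
      using a v by (auto simp: K upd mat_vec_eq_iff bit_add_eq_0_iff) (auto simp: vecs_def)
    show "(x(a := 1))(a := 0) = x" if "x \<in> ?B" for x using that a by (auto simp: vecs_def)
    show "(y(a := 0))(a := 1) = y" if "y \<in> {y \<in> ?K. y a = 1}" for y using that by (auto simp: fun_eq_iff)
  qed
  then have "card {y \<in> ?K. y a = 1} = card ?B" by (simp add: bij_betw_same_card)
  moreover have "?K = {y \<in> ?K. y a = 0} \<union> {y \<in> ?K. y a = 1}" using bit_not_zero_iff by blast
  moreover have "card ({y \<in> ?K. y a = 0} \<union> {y \<in> ?K. y a = 1}) = card {y \<in> ?K. y a = 0} + card {y \<in> ?K. y a = 1}"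
    using fin by (intro card_Un_disjoint) auto
  ultimately show ?thesis by simp
qed

text \<open>Outside the range, \<open>v\<close> fails to be orthogonal to the kernel of
  \<open>S\<close>, so it cuts that kernel in half, and there are no kernel vectors with
  \<open>a\<close>-coordinate \<open>1\<close>.\<close>

lemma card_mat_ker_border_notin:
  assumes fin: "finite I" and a: "a \<notin> I" and S: "S \<in> sym_mats I"
    and v: "v \<in> vecs I" "v \<notin> mat_vec I S ` vecs I"
  shows "2 * card (mat_ker (insert a I) (border a S v c)) = card (mat_ker I S)"
proof -
  obtain w where w: "w \<in> mat_ker I S" "dot I v w = 1"
    using v unfolding mat_range_eq_orthogonal_ker[OF fin S] by (auto simp: dot_commute[of I v])
  have "card (mat_ker I S) = 2 * card {x \<in> mat_ker I S. dot I v x = 0}"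
    using card_zeros_of_functional[where g = "dot I v", OF subspace_mat_ker _ _ w] fin by (simp add: dot_add_right)
  moreover have "{x \<in> vecs I. mat_vec I S x = v \<and> dot I v x = c} = {}" using v by auto
  ultimately show ?thesis by (simp only: card_mat_ker_border[OF fin a v(1)] card.empty add_0_right)
qed

text \<open>Now \<open>v\<close> is orthogonal to the whole kernel of \<open>S\<close>. By symmetry
  \<open>v\<close> takes the constant value \<open>dot I v u\<close> on the solutions of
  \<open>S x = v\<close>, so the corner \<open>c\<close> admits either all of these solutions or
  none.\<close>

lemma card_mat_ker_border_in:
  assumes fin: "finite I" and a: "a \<notin> I" and S: "S \<in> sym_mats I" and u: "u \<in> vecs I"
  defines "v \<equiv> mat_vec I S u"
  shows "card (mat_ker (insert a I) (border a S v c)) =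
    (if dot I v u = c then 2 * card (mat_ker I S) else card (mat_ker I S))"
proof -
  have "dot I v x = dot I u v" if "mat_vec I S x = v" for x
    using that by (simp add: v_def dot_mat_vec_sym[OF S, symmetric])
  then have "{x \<in> vecs I. mat_vec I S x = v \<and> dot I v x = c} =
      (if dot I v u = c then {x \<in> vecs I. mat_vec I S x = v} else {})"
    by (auto simp: dot_commute)
  moreover have "{x \<in> mat_ker I S. dot I v x = 0} = mat_ker I S"
    by (auto simp: v_def dot_mat_vec_sym[OF S, symmetric] mat_ker_def)
  moreover have "card {x \<in> vecs I. mat_vec I S x = v} = card (mat_ker I S)"
    using u by (intro card_fiber_mat_vec) (simp add: v_def)
  ultimately show ?thesis
    using card_mat_ker_border[OF fin a, of v S c] by (simp add: v_def)
qed

text \<open>The three summands are the borders that lower, keep and raise the nullity. A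
  \<open>v\<close> outside the range lowers it for both corners \<open>c\<close>; a \<open>v\<close>
  in the range keeps it for one corner and raises it for the other.\<close>

lemma card_borders:
  assumes fin: "finite I" and a: "a \<notin> I" and S: "S \<in> sym_mats I"
  defines "r \<equiv> card (mat_vec I S ` vecs I)" and "\<kappa> \<equiv> card (mat_ker I S)"
  shows "card {(v, c). v \<in> vecs I \<and> card (mat_ker (insert a I) (border a S v c)) = K} =
    (if \<kappa> = 2 * K then 2 * (2 ^ card I - r) else 0) + (if \<kappa> = K then r else 0) + (if 2 * \<kappa> = K then r else 0)"
proof -
  let ?R = "mat_vec I S ` vecs I"
  let ?C = "\<lambda>v. {c. card (mat_ker (insert a I) (border a S v c)) = K}"
  have \<kappa>: "\<kappa> > 0" using card_mat_ker_pos[OF fin] by (simp add: \<kappa>_def)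
  have out: "card (?C v) = (if \<kappa> = 2 * K then 2 else 0)" if "v \<in> vecs I - ?R" for v
  proof -
    have "2 * card (mat_ker (insert a I) (border a S v c)) = \<kappa>" for c
      using card_mat_ker_border_notin[OF fin a S, of v c] that by (simp add: \<kappa>_def)
    then have "card (mat_ker (insert a I) (border a S v c)) = K \<longleftrightarrow> \<kappa> = 2 * K" for c
      by (metis mult_left_cancel zero_neq_numeral)
    then have "?C v = (if \<kappa> = 2 * K then UNIV else {})" by auto
    then show ?thesis by (simp add: UNIV_bit)
  qed
  have inr: "card (?C v) = (if \<kappa> = K then 1 else 0) + (if 2 * \<kappa> = K then 1 else 0)" if v: "v \<in> ?R" for v
  proof -
    obtain u where u: "u \<in> vecs I" "v = mat_vec I S u" using v by auto
    have "?C v = {c. (if dot I v u = c then 2 * \<kappa> else \<kappa>) = K}"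
      using card_mat_ker_border_in[OF fin a S u(1)] u(2) by (simp add: \<kappa>_def)
    also have "\<dots> = (if \<kappa> = K then {dot I v u + 1} else if 2 * \<kappa> = K then {dot I v u} else {})"
    proof (rule set_eqI)
      show "c \<in> {c. (if dot I v u = c then 2 * \<kappa> else \<kappa>) = K} \<longleftrightarrow>
          c \<in> (if \<kappa> = K then {dot I v u + 1} else if 2 * \<kappa> = K then {dot I v u} else {})" for c
        using \<kappa> by (cases c; cases "dot I v u") auto
    qed
    finally show ?thesis using \<kappa> by simp
  qed
  have sub: "?R \<subseteq> vecs I" by auto
  have "{(v, c). v \<in> vecs I \<and> card (mat_ker (insert a I) (border a S v c)) = K} = Sigma (vecs I) ?C" by auto
  also have "card \<dots> = (\<Sum>v\<in>vecs I. card (?C v))" using fin by (intro card_SigmaI) auto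
  also have "\<dots> = (\<Sum>v\<in>vecs I - ?R. card (?C v)) + (\<Sum>v\<in>?R. card (?C v))"
    using fin sub by (intro sum.subset_diff) auto
  also have "(\<Sum>v\<in>vecs I - ?R. card (?C v)) = (if \<kappa> = 2 * K then 2 * (2 ^ card I - r) else 0)"
    using fin sub by (simp add: out card_Diff_subset card_vecs r_def)
  also have "(\<Sum>v\<in>?R. card (?C v)) = (if \<kappa> = K then r else 0) + (if 2 * \<kappa> = K then r else 0)"
    by (simp add: inr r_def)
  finally show ?thesis by simp
qed

lemma card_mat_ker_power2:
  assumes "finite I"
  obtains k where "k \<le> card I" "card (mat_ker I S) = 2 ^ k"
proof -
  have "card (mat_ker I S) dvd 2 ^ card I" using card_mat_range[OF assms, of S] by (metis dvd_triv_right)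
  then show ?thesis using that by (auto simp: divides_primepow_nat)
qed

section \<open>The recurrence for the nullity distribution and its solution\<close>

definition nullity_count :: "'a set \<Rightarrow> nat \<Rightarrow> nat" where
  "nullity_count I k = card {S \<in> sym_mats I. card (mat_ker I S) = 2 ^ k}"

text \<open>Sums \<open>card_borders\<close> over all \<open>S\<close>, with the size of the range
  replaced by \<open>2 ^ m\<close> divided by the size of the kernel. The contributing
  \<open>S\<close> have nullity \<open>k + 1\<close>, \<open>k\<close> or
  \<open>k - 1\<close>.\<close>

lemma nullity_count_insert:
  assumes fin: "finite I" and a: "a \<notin> I"
  defines "m \<equiv> card I"
  shows "real (nullity_count (insert a I) k) =
    2 * (2 ^ m - 2 ^ m / 2 ^ Suc k) * nullity_count I (Suc k) + 2 ^ m / 2 ^ k * nullity_count I k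
    + (if k = 0 then 0 else 2 ^ m / 2 ^ (k - 1) * nullity_count I (k - 1))"
proof -
  let ?D = "\<lambda>S. {(v, c). v \<in> vecs I \<and> card (mat_ker (insert a I) (border a S v c)) = 2 ^ k}"
  let ?\<kappa> = "\<lambda>S. card (mat_ker I S)"
  let ?f = "\<lambda>(S, v, c). border a S v c"
  note bij_betw_restrict[OF bij_betw_border[OF a], of "\<lambda>M. card (mat_ker (insert a I) M) = 2 ^ k"]
  moreover have "{p \<in> sym_mats I \<times> vecs I \<times> UNIV. card (mat_ker (insert a I) (?f p)) = 2 ^ k} = Sigma (sym_mats I) ?D"
    by auto
  ultimately have "bij_betw ?f (Sigma (sym_mats I) ?D) {M \<in> sym_mats (insert a I). card (mat_ker (insert a I) M) = 2 ^ k}"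
    by (simp only:)
  then have "nullity_count (insert a I) k = card (Sigma (sym_mats I) ?D)"
    unfolding nullity_count_def by (rule bij_betw_same_card[symmetric])
  also have "\<dots> = (\<Sum>S\<in>sym_mats I. card (?D S))"
  proof (intro card_SigmaI ballI)
    fix S
    show "finite (?D S)" by (rule finite_subset[of _ "vecs I \<times> UNIV"]) (use fin in auto)
  qed (use fin in auto)
  finally have "real (nullity_count (insert a I) k) = (\<Sum>S\<in>sym_mats I. real (card (?D S)))" by simp
  also have "\<dots> = (\<Sum>S\<in>sym_mats I.
      (if ?\<kappa> S = 2 ^ Suc k then 2 * (2 ^ m - 2 ^ m / 2 ^ Suc k) else 0)
      + (if ?\<kappa> S = 2 ^ k then 2 ^ m / 2 ^ k else 0)
      + (if k = 0 then 0 else if ?\<kappa> S = 2 ^ (k - 1) then 2 ^ m / 2 ^ (k - 1) else 0))"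
  proof (rule sum.cong)
    fix S assume S: "S \<in> sym_mats I"
    let ?r = "card (mat_vec I S ` vecs I)"
    have rk: "?r * ?\<kappa> S = 2 ^ m" using card_mat_range[OF fin] by (simp add: m_def)
    have pos: "?\<kappa> S > 0" using card_mat_ker_pos[OF fin] .
    have "real ?r * real (?\<kappa> S) = 2 ^ m" using arg_cong[OF rk, of real] by simp
    then have r: "real ?r = 2 ^ m / real (?\<kappa> S)" using pos by (simp add: field_simps)
    have le: "?r \<le> 2 ^ m" unfolding rk[symmetric] using pos by simp
    \<comment> \<open>For \<open>k = 0\<close> there is no smaller nullity to raise, while truncated
      subtraction would make \<open>k - 1\<close> equal to \<open>0\<close>; hence the separate
      case.\<close>
    have two: "2 * ?\<kappa> S = 2 ^ k \<longleftrightarrow> k \<noteq> 0 \<and> ?\<kappa> S = 2 ^ (k - 1)" by (cases k) auto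
    show "real (card (?D S)) =
      (if ?\<kappa> S = 2 ^ Suc k then 2 * (2 ^ m - 2 ^ m / 2 ^ Suc k) else 0)
      + (if ?\<kappa> S = 2 ^ k then 2 ^ m / 2 ^ k else 0)
      + (if k = 0 then 0 else if ?\<kappa> S = 2 ^ (k - 1) then 2 ^ m / 2 ^ (k - 1) else 0)"
      unfolding card_borders[OF fin a S] two m_def[symmetric] using le by (auto simp: of_nat_diff r)
  qed simp
  also have "\<dots> = 2 * (2 ^ m - 2 ^ m / 2 ^ Suc k) * nullity_count I (Suc k) + 2 ^ m / 2 ^ k * nullity_count I k
    + (if k = 0 then 0 else 2 ^ m / 2 ^ (k - 1) * nullity_count I (k - 1))"
  proof -
    have sum_if: "(\<Sum>S\<in>sym_mats I. if ?\<kappa> S = 2 ^ j then x else 0) = x * real (nullity_count I j)" for j x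
      using fin by (simp add: nullity_count_def sum.If_cases Int_def)
    show ?thesis
      unfolding sum.distrib sum_if by (cases "k = 0") (simp_all only: sum_if if_True if_False sum.neutral_const simp_thms)
  qed
  finally show ?thesis .
qed

text \<open>For \<open>k \<le> m\<close> this is the number of symmetric \<open>m\<close> by
  \<open>m\<close> matrices over the two-element field with nullity \<open>k\<close>. For
  \<open>k > m\<close> both products are empty and the value is \<open>1\<close>, although no such
  matrix exists.\<close>

definition nullity_formula :: "nat \<Rightarrow> nat \<Rightarrow> real" where
  "nullity_formula m k = (\<Prod>i = 1..(m - k) div 2. inverse (1 - 1 / 2 ^ (2 * i))) * (\<Prod>i = k + 1..m. 2 ^ i - 1)"

text \<open>The recurrence of \<open>nullity_count_insert\<close>. Writing \<open>m = k + d\<close>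
  removes truncated subtraction, and the test \<open>d = 0\<close> replaces the spurious value
  \<open>1\<close> at nullity \<open>m + 1\<close> by \<open>0\<close>.\<close>

lemma nullity_formula_Suc:
  fixes k d :: nat
  defines "m \<equiv> k + d"
  shows "nullity_formula (Suc m) k =
    2 * (2 ^ m - 2 ^ m / 2 ^ Suc k) * (if d = 0 then 0 else nullity_formula m (Suc k))
    + 2 ^ m / 2 ^ k * nullity_formula m k
    + (if k = 0 then 0 else 2 ^ m / 2 ^ (k - 1) * nullity_formula m (k - 1))"
proof -
  define P where "P s = (\<Prod>i = 1..s. inverse (1 - 1 / 2 ^ (2 * i)) :: real)" for s :: nat
  define Q where "Q k m = (\<Prod>i = k + 1..m. 2 ^ i - 1 :: real)" for k m :: nat
  have F: "nullity_formula m k = P ((m - k) div 2) * Q k m" for m k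
    by (simp add: nullity_formula_def P_def Q_def)
  have P_Suc: "P (Suc s) * (1 - 1 / 2 ^ (2 * Suc s)) = P s" for s
    using one_less_power[of "2::real" "2 * Suc s"] by (simp add: P_def field_simps)
  have Q_Suc: "Q k (Suc m) = Q k m * (2 ^ Suc m - 1)" by (simp add: Q_def m_def)
  have Q_low: "Q k' m = (2 ^ Suc k' - 1) * Q (Suc k') m" if "k' < m" for k'
    using that by (simp add: Q_def prod.atLeast_Suc_atMost[of "Suc k'" m])
  \<comment> \<open>After the factor \<open>Q k m\<close> is cancelled, only this identity in
    \<open>d\<close> remains. For odd \<open>d\<close>, and for even \<open>d > 0\<close>, one
    factor of \<open>P\<close> is peeled off by \<open>P_Suc\<close>.\<close>
  have core: "P (Suc d div 2) * (2 ^ Suc d - 1) = (if d = 0 then 0 else 2 ^ d * P ((d - 1) div 2)) + 2 ^ d * P (d div 2)"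
  proof (cases "even d")
    case True
    then obtain s where s: "d = 2 * s" by blast
    show ?thesis
    proof (cases s)
      case 0
      then show ?thesis by (simp add: s)
    next
      case (Suc t)
      have "(d - 1) div 2 = t" "d div 2 = Suc t" "Suc d div 2 = Suc t" using s Suc by auto
      moreover have "P t = P (Suc t) * (1 - 1 / 2 ^ d)" using P_Suc[of t] s Suc by simp
      ultimately show ?thesis using s Suc by (simp add: field_simps)
    qed
  next
    case False
    then obtain s where s: "d = Suc (2 * s)" by (metis oddE Suc_eq_plus1)
    have "P s = P (Suc s) * (1 - 1 / 2 ^ Suc d)" using P_Suc[of s] s by simp
    then show ?thesis using s by (simp add: field_simps)
  qed
  have T1: "2 * (2 ^ m - 2 ^ m / 2 ^ Suc k) * (if d = 0 then 0 else nullity_formula m (Suc k))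
      = (if d = 0 then 0 else 2 ^ d * P ((d - 1) div 2)) * Q k m"
  proof (cases d)
    case (Suc e)
    have "m - Suc k = e" "k < m" using Suc by (auto simp: m_def)
    then show ?thesis unfolding F Q_low[OF \<open>k < m\<close>] Suc
      by (simp add: m_def Suc power_add field_simps)
  qed simp
  have T3: "(if k = 0 then 0 else 2 ^ m / 2 ^ (k - 1) * nullity_formula m (k - 1))
      = 2 ^ Suc d * (2 ^ k - 1) * P (Suc d div 2) * Q k m"
  proof (cases k)
    case (Suc j)
    have "m - j = Suc d" "j < m" using Suc by (auto simp: m_def)
    then show ?thesis unfolding F Suc using Q_low[OF \<open>j < m\<close>]
      by (simp add: m_def Suc power_add)
  qed simp
  have "nullity_formula (Suc m) k = P (Suc d div 2) * (2 ^ Suc m - 1) * Q k m"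
    by (simp add: F Q_Suc) (simp add: m_def)
  \<comment> \<open>Splits \<open>2 ^ Suc m - 1\<close> so that the second part is exactly the
    nullity-raising term \<open>T3\<close> and the first part is the left side of
    \<open>core\<close>.\<close>
  also have "P (Suc d div 2) * (2 ^ Suc m - 1) = P (Suc d div 2) * (2 ^ Suc d - 1) + 2 ^ Suc d * (2 ^ k - 1) * P (Suc d div 2)"
    by (simp add: m_def power_add algebra_simps)
  also have "\<dots> * Q k m = (if d = 0 then 0 else 2 ^ d * P ((d - 1) div 2)) * Q k m
      + 2 ^ m / 2 ^ k * nullity_formula m k + 2 ^ Suc d * (2 ^ k - 1) * P (Suc d div 2) * Q k m"
    unfolding core by (simp add: F m_def power_add algebra_simps)
  finally show ?thesis unfolding T1 T3 .
qed

lemma nullity_count_eq_0: "finite I \<Longrightarrow> card I < k \<Longrightarrow> nullity_count I k = 0"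
proof -
  assume "finite I" "card I < k"
  then have "card (mat_ker I S) \<noteq> 2 ^ k" for S
    using card_mat_ker_power2[of I S] by force
  then show ?thesis by (simp add: nullity_count_def)
qed

lemma nullity_count_eq:
  assumes "finite I" "k \<le> card I"
  shows "real (nullity_count I k) = nullity_formula (card I) k"
  using assms
proof (induction I arbitrary: k rule: finite_induct)
  case empty
  then have "{S \<in> sym_mats {}. card (mat_ker {} S) = 2 ^ k} = {0 :: 'a \<Rightarrow> 'a \<Rightarrow> bit}"
    using card_mat_ker_power2[of "{} :: 'a set" 0] by (auto simp: sym_mats_empty)
  then show ?case using empty by (simp add: nullity_count_def nullity_formula_def)
next
  case (insert a I)
  let ?m = "card I"
  show ?case
  \<comment> \<open>At the maximal nullity \<open>d\<close> would be negative, so the recurrence is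
    evaluated directly: only its raising term survives.\<close>
  proof (cases "k = Suc ?m")
    case True
    then show ?thesis using insert
      by (simp add: nullity_count_insert nullity_count_eq_0 nullity_formula_def)
  next
    case False
    then have "k \<le> ?m" using insert by simp
    then obtain d where d: "?m = k + d" using le_Suc_ex by blast
    have "real (nullity_count I (Suc k)) = (if d = 0 then 0 else nullity_formula ?m (Suc k))"
      using insert d by (simp add: nullity_count_eq_0)
    then show ?thesis
      using nullity_formula_Suc[of k d] insert d by (simp add: nullity_count_insert)
  qed
qed

subsection \<open>Symmetric matrices with unit row sums\<close>

lemma of_nat_bit: "of_nat n = (of_bool (odd n) :: bit)"
  by (induction n) auto

lemma sum_const_bit: "(\<Sum>i\<in>I. c) = (if even (card I) then 0 else c :: bit)"
  by (simp add: of_nat_bit)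

definition row_sum_one_mats :: "'a set \<Rightarrow> ('a \<Rightarrow> 'a \<Rightarrow> bit) set" where
  "row_sum_one_mats I = {M \<in> sym_mats I. \<forall>i\<in>I. (\<Sum>j\<in>I. M i j) = 1}"

lemma sum_row_insert:
  assumes "M \<in> row_sum_one_mats (insert a I)" "finite I" "a \<notin> I" "i \<in> insert a I"
  shows "(\<Sum>j\<in>I. M i j) = 1 + M i a"
proof -
  have "M i a + (\<Sum>j\<in>I. M i j) = (\<Sum>j\<in>insert a I. M i j)" using assms by simp
  also have "\<dots> = 1" using assms unfolding row_sum_one_mats_def by blast
  finally show ?thesis by (metis add.commute bit_add_self(2))
qed

text \<open>By symmetry, pairing the all-ones vector with \<open>M y\<close> is pairing its image
  under \<open>M\<close>, which is itself, with \<open>y\<close>.\<close>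

lemma sum_dot_row_sum_one:
  assumes "M \<in> row_sum_one_mats I"
  shows "(\<Sum>i\<in>I. dot I (M i) y) = (\<Sum>i\<in>I. y i)"
proof -
  have M: "M i j = M j i" "j \<in> I \<Longrightarrow> (\<Sum>i\<in>I. M j i) = 1" for i j
    using assms by (auto simp: row_sum_one_mats_def sym_mats_def)
  have "(\<Sum>i\<in>I. dot I (M i) y) = (\<Sum>j\<in>I. \<Sum>i\<in>I. M i j * y j)"
    unfolding dot_def by (rule sum.swap)
  also have "\<dots> = (\<Sum>j\<in>I. (\<Sum>i\<in>I. M j i) * y j)"
    by (simp add: sum_distrib_right M(1)[of _ j for j])
  also have "\<dots> = (\<Sum>j\<in>I. y j)" by (intro sum.cong) (simp_all add: M)
  finally show ?thesis .
qed

text \<open>Since \<open>M 1 = 1\<close>, adding \<open>x\<^sub>a\<close> times the all-ones vector to \<open>x \<in> ker M\<close> gives a vector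
  with vanishing \<open>a\<close>-entry which \<open>M\<close> maps to a constant vector.\<close>

lemma card_mat_ker_row_sum_one:
  assumes fin: "finite I" and a: "a \<notin> I" and M: "M \<in> row_sum_one_mats (insert a I)"
  shows "card (mat_ker (insert a I) M) = card {y \<in> vecs I. \<forall>i\<in>I. dot I (M i) y = dot I (M a) y}"
proof -
  let ?J = "insert a I"
  define one where "one t j = (if j \<in> ?J then t else 0)" for t :: bit and j
  \<comment> \<open>The inverse can recover \<open>x a\<close> because \<open>M\<close> fixes
    multiples of the all-ones vector: \<open>M\<close> maps \<open>?f x\<close> to the constant
    vector \<open>x a\<close>, which row \<open>a\<close> reads off.\<close>
  let ?f = "\<lambda>x. x + one (x a)" and ?g = "\<lambda>y. y + one (dot I (M a) y)"
  have row: "dot ?J (M i) (one t) = t" if "i \<in> ?J" for i t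
  proof -
    have "dot ?J (M i) (one t) = (\<Sum>j\<in>?J. M i j) * t"
      unfolding dot_def sum_distrib_right by (intro sum.cong) (auto simp: one_def)
    then show ?thesis using M that by (simp only: row_sum_one_mats_def mem_Collect_eq) simp
  qed
  have I: "dot ?J z y = dot I z y" if "y \<in> vecs I" for y z
    using fin a that by (simp add: dot_insert vecs_def)
  have "bij_betw ?f (mat_ker ?J M) {y \<in> vecs I. \<forall>i\<in>I. dot I (M i) y = dot I (M a) y}"
  proof (rule bij_betwI[where g = ?g])
    have f: "?f x \<in> vecs I" "i \<in> ?J \<Longrightarrow> dot I (M i) (?f x) = x a" if "x \<in> mat_ker ?J M" for x i
    proof -
      show v: "?f x \<in> vecs I" using that by (auto simp: mat_ker_iff vecs_def one_def)
      show "dot I (M i) (?f x) = x a" if "i \<in> ?J"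
        unfolding I[OF v, symmetric] using \<open>x \<in> mat_ker ?J M\<close> that
        by (auto simp: dot_add_right row mat_ker_iff)
    qed
    show "?f \<in> mat_ker ?J M \<rightarrow> {y \<in> vecs I. \<forall>i\<in>I. dot I (M i) y = dot I (M a) y}"
      using f by simp
    show "?g (?f x) = x" if "x \<in> mat_ker ?J M" for x
    proof -
      have "dot I (M a) (?f x) = x a" using f(2)[OF that, of a] by simp
      then show ?thesis by (simp add: add.assoc)
    qed
    show "?g \<in> {y \<in> vecs I. \<forall>i\<in>I. dot I (M i) y = dot I (M a) y} \<rightarrow> mat_ker ?J M"
      by (auto simp: mat_ker_iff dot_add_right row I) (auto simp: vecs_def one_def)
    show "?f (?g y) = y" if "y \<in> {y \<in> vecs I. \<forall>i\<in>I. dot I (M i) y = dot I (M a) y}" for y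
    proof -
      have "y a = 0" using that a by (simp add: vecs_def)
      then have "?g y a = dot I (M a) y" by (simp add: one_def)
      then show ?thesis by (simp add: add.assoc)
    qed
  qed
  then show ?thesis by (rule bij_betw_same_card)
qed

section \<open>Odd order: reduction to arbitrary symmetric matrices\<close>

text \<open>If \<open>M\<close> fixes the all-ones vector \<open>1\<close> and
  \<open>insert a I\<close> has odd size, this is the Gram matrix of the form \<open>M\<close> in
  the vectors \<open>e_i + 1\<close> for \<open>i\<close> in \<open>I\<close>, a basis of the
  orthogonal complement of \<open>1\<close>.\<close>

definition shift_block :: "'a set \<Rightarrow> ('a \<Rightarrow> 'a \<Rightarrow> bit) \<Rightarrow> 'a \<Rightarrow> 'a \<Rightarrow> bit" where
  "shift_block I M i j = (if i \<in> I \<and> j \<in> I then M i j + 1 else 0)"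

text \<open>Shifting twice restores the block on \<open>I\<close>. The row sums then determine row
  \<open>a\<close> off the diagonal, and finally the corner. As \<open>card I\<close> is even, the
  shift does not change the sums over \<open>I\<close>.\<close>

lemma bij_betw_shift_block:
  assumes fin: "finite I" and a: "a \<notin> I" and ev: "even (card I)"
  shows "bij_betw (shift_block I) (row_sum_one_mats (insert a I)) (sym_mats I)"
proof (rule bij_betwI[where g = "\<lambda>T. border a (shift_block I T) (\<lambda>i. if i \<in> I then 1 + (\<Sum>j\<in>I. T i j) else 0)
    (1 + (\<Sum>i\<in>I. \<Sum>j\<in>I. T i j))"])
  let ?J = "insert a I"
  let ?g = "\<lambda>T. border a (shift_block I T) (\<lambda>i. if i \<in> I then 1 + (\<Sum>j\<in>I. T i j) else 0)
    (1 + (\<Sum>i\<in>I. \<Sum>j\<in>I. T i j))"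
  have neq: "i \<noteq> a" if "i \<in> I" for i using that a by auto
  show "shift_block I \<in> row_sum_one_mats ?J \<rightarrow> sym_mats I"
    by (auto simp: shift_block_def row_sum_one_mats_def sym_mats_def)
  show "?g \<in> sym_mats I \<rightarrow> row_sum_one_mats ?J"
  proof
    fix T :: "'a \<Rightarrow> 'a \<Rightarrow> bit" assume T: "T \<in> sym_mats I"
    have "?g T \<in> sym_mats ?J"
      using T by (auto simp: sym_mats_def border_def shift_block_def)
    moreover have "(\<Sum>j\<in>?J. ?g T i j) = 1" if "i \<in> ?J" for i
    proof (cases "i = a")
      case True
      have "(\<Sum>j\<in>I. ?g T a j) = (\<Sum>i\<in>I. 1 + (\<Sum>j\<in>I. T i j))"
        by (intro sum.cong) (auto simp: border_def neq)
      also have "\<dots> = (\<Sum>i\<in>I. \<Sum>j\<in>I. T i j)"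
        unfolding sum.distrib sum_const_bit using ev by simp
      finally show ?thesis using True fin a by (simp add: border_def add.commute)
    next
      case False
      then have "(\<Sum>j\<in>I. ?g T i j) = (\<Sum>j\<in>I. T i j + 1)"
        using that by (intro sum.cong) (auto simp: border_def shift_block_def neq)
      also have "\<dots> = (\<Sum>j\<in>I. T i j)" unfolding sum.distrib sum_const_bit using ev by simp
      finally show ?thesis using False that fin a by (simp add: border_def add.assoc)
    qed
    ultimately show "?g T \<in> row_sum_one_mats ?J" by (simp only: row_sum_one_mats_def) blast
  qed
  show "shift_block I (?g T) = T" if "T \<in> sym_mats I" for T
    using sym_mats_outside[OF that] by (auto simp: fun_eq_iff shift_block_def border_def neq add.assoc)
  show "?g (shift_block I M) = M" if M: "M \<in> row_sum_one_mats ?J" for M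
  proof (intro ext)
    fix i j
    have sym: "M i j = M j i" and out: "i \<notin> ?J \<Longrightarrow> M i j = 0" "j \<notin> ?J \<Longrightarrow> M i j = 0" for i j
      using M by (auto simp: row_sum_one_mats_def sym_mats_def)
    have s: "(\<Sum>j\<in>I. shift_block I M i j) = (\<Sum>j\<in>I. M i j)" if "i \<in> I" for i
    proof -
      have "(\<Sum>j\<in>I. shift_block I M i j) = (\<Sum>j\<in>I. M i j + 1)"
        using that by (intro sum.cong) (auto simp: shift_block_def)
      then show ?thesis unfolding sum.distrib sum_const_bit using ev by simp
    qed
    have rw: "1 + (\<Sum>j\<in>I. M i j) = M i a" if "i \<in> ?J" for i
      using sum_row_insert[OF M fin a that] by simp
    have "(\<Sum>i\<in>I. \<Sum>j\<in>I. shift_block I M i j) = (\<Sum>i\<in>I. 1 + (1 + (\<Sum>j\<in>I. M i j)))"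
      by (intro sum.cong) (simp_all add: s)
    also have "\<dots> = (\<Sum>i\<in>I. 1 + M a i)" using rw by (intro sum.cong) (simp_all add: sym[of a])
    also have "\<dots> = (\<Sum>i\<in>I. M a i)" unfolding sum.distrib sum_const_bit using ev by simp
    finally have corner: "1 + (\<Sum>i\<in>I. \<Sum>j\<in>I. shift_block I M i j) = M a a" using rw[of a] by simp
    have edge: "(if i \<in> I then 1 + (\<Sum>j\<in>I. shift_block I M i j) else 0) = M i a" if "i \<noteq> a" for i
      using that rw[of i] s[of i] out(1)[of i a] by simp
    have block: "shift_block I (shift_block I M) i j = M i j" if "i \<noteq> a" "j \<noteq> a"
      using that out(1)[of i j] out(2)[of j i] by (auto simp: shift_block_def add.assoc)
    show "?g (shift_block I M) i j = M i j"
      using corner edge[of i] edge[of j] block sym[of a j]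
      by (cases "i = a"; cases "j = a") (simp_all only: border_def if_True if_False simp_thms)
  qed
qed

text \<open>If \<open>M y\<close> is constant on \<open>I\<close>, its entries over \<open>I\<close>
  sum to \<open>0\<close> since \<open>card I\<close> is even, so its \<open>a\<close>-entry must be
  the sum of \<open>y\<close>. The condition thus says that every entry on \<open>I\<close> equals
  that sum, which is what adding \<open>1\<close> to all entries of the block expresses.\<close>

lemma card_mat_ker_shift_block:
  assumes fin: "finite I" and a: "a \<notin> I" and ev: "even (card I)" and M: "M \<in> row_sum_one_mats (insert a I)"
  shows "card (mat_ker (insert a I) M) = card (mat_ker I (shift_block I M))"
proof -
  have "(\<forall>i\<in>I. dot I (M i) y = dot I (M a) y) \<longleftrightarrow> (\<forall>i\<in>I. dot I (shift_block I M i) y = 0)"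
    if y: "y \<in> vecs I" for y
  proof -
    let ?s = "\<Sum>i\<in>I. y i"
    have sh: "dot I (shift_block I M i) y = dot I (M i) y + ?s" if "i \<in> I" for i
      using that by (simp add: dot_def shift_block_def algebra_simps sum.distrib cong: sum.cong)
    have "y a = 0" using y a by (simp add: vecs_def)
    then have tot: "dot I (M a) y + (\<Sum>i\<in>I. dot I (M i) y) = ?s"
      using sum_dot_row_sum_one[OF M, of y] fin a by (simp add: dot_insert)
    have const: "dot I (M a) y = ?s" if "\<And>i. i \<in> I \<Longrightarrow> dot I (M i) y = t" for t
    proof -
      have "(\<Sum>i\<in>I. dot I (M i) y) = (\<Sum>i\<in>I. t)" by (intro sum.cong) (simp_all add: that)
      then show ?thesis using tot unfolding sum_const_bit using ev by simp
    qed
    have "(\<forall>i\<in>I. dot I (M i) y = dot I (M a) y) \<longleftrightarrow> (\<forall>i\<in>I. dot I (M i) y = ?s)"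
      using const by metis
    then show ?thesis by (simp add: sh bit_add_eq_0_iff)
  qed
  then show ?thesis
    unfolding card_mat_ker_row_sum_one[OF fin a M] by (intro arg_cong[where f = card] set_eqI) (simp add: mat_ker_iff cong: conj_cong)
qed

section \<open>Even order: deletion of a vertex after switching\<close>

text \<open>Seidel switching at the neighbourhood of \<open>a\<close>, followed by complementation if the degree
  \<open>M a a + 1\<close> of \<open>a\<close> is odd.\<close>

definition switch_block :: "'a \<Rightarrow> 'a set \<Rightarrow> ('a \<Rightarrow> 'a \<Rightarrow> bit) \<Rightarrow> 'a \<Rightarrow> 'a \<Rightarrow> bit" where
  "switch_block a I M i j = (if i \<in> I \<and> j \<in> I then M i j + (M a i + (M a j + (M a a + 1))) else 0)"

lemma sum_add_switch:
  assumes "odd (card I)"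
  shows "(\<Sum>j\<in>I. f j + (p + (g j + q))) = (\<Sum>j\<in>I. f j) + (p + ((\<Sum>j\<in>I. g j) + (q :: bit)))"
  unfolding sum.distrib sum_const_bit using assms by simp

text \<open>The switched block alone forgets the neighbourhood of \<open>a\<close>, so row
  \<open>a\<close> is kept as a second, freely chosen component.\<close>

lemma bij_betw_switch_block:
  assumes fin: "finite I" and a: "a \<notin> I" and od: "odd (card I)"
  shows "bij_betw (\<lambda>M. (\<lambda>i. if i \<in> I then M a i else 0, switch_block a I M))
    (row_sum_one_mats (insert a I)) (vecs I \<times> row_sum_one_mats I)"
\<comment> \<open>The row sum of row \<open>a\<close> gives \<open>M a a + 1\<close> as the sum of
  \<open>w\<close>. So the inverse can add the same correction again and set the corner without
  knowing \<open>M\<close>.\<close>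
proof (rule bij_betwI[where g = "\<lambda>(w, T). border a
    (\<lambda>i j. if i \<in> I \<and> j \<in> I then T i j + (w i + (w j + (\<Sum>k\<in>I. w k))) else 0) w (1 + (\<Sum>k\<in>I. w k))"])
  let ?J = "insert a I"
  let ?f = "\<lambda>M. (\<lambda>i. if i \<in> I then M a i else 0, switch_block a I M)"
  let ?g = "\<lambda>(w, T). border a
    (\<lambda>i j. if i \<in> I \<and> j \<in> I then T i j + (w i + (w j + (\<Sum>k\<in>I. w k))) else 0) w (1 + (\<Sum>k\<in>I. w k))"
  have neq: "i \<noteq> a" if "i \<in> I" for i using that a by auto
  have sym: "M i j = M j i" if "M \<in> row_sum_one_mats ?J" for M i j
    using that by (auto simp: row_sum_one_mats_def sym_mats_def)
  have out: "M i j = 0" if "M \<in> row_sum_one_mats ?J" "i \<notin> ?J \<or> j \<notin> ?J" for M i j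
    using sym_mats_outside that by (force simp: row_sum_one_mats_def)
  have row: "(\<Sum>j\<in>I. M i j) = 1 + M a i" if "M \<in> row_sum_one_mats ?J" "i \<in> ?J" for M i
    using sum_row_insert[OF that(1) fin a that(2)] sym[OF that(1), of i a] by simp
  show "?f \<in> row_sum_one_mats ?J \<rightarrow> vecs I \<times> row_sum_one_mats I"
  proof
    fix N assume N: "N \<in> row_sum_one_mats ?J"
    have "switch_block a I N \<in> sym_mats I"
      using sym[OF N] by (auto simp: sym_mats_def switch_block_def algebra_simps)
    moreover have "(\<Sum>j\<in>I. switch_block a I N i j) = 1" if "i \<in> I" for i
    proof -
      have "(\<Sum>j\<in>I. switch_block a I N i j) = (\<Sum>j\<in>I. N i j + (N a i + (N a j + (N a a + 1))))"
        using that by (intro sum.cong) (simp_all add: switch_block_def)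
      also have "\<dots> = 1" unfolding sum_add_switch[OF od]
        using row[OF N, of i] row[OF N, of a] that by (simp add: add.assoc add.commute[of "N a a"])
      finally show ?thesis .
    qed
    ultimately show "?f N \<in> vecs I \<times> row_sum_one_mats I"
      by (simp add: row_sum_one_mats_def vecs_def)
  qed
  show "?g \<in> vecs I \<times> row_sum_one_mats I \<rightarrow> row_sum_one_mats ?J"
  proof
    fix p assume "p \<in> vecs I \<times> row_sum_one_mats I"
    then obtain w T where p: "p = (w, T)" and w: "w \<in> vecs I" and T: "T \<in> row_sum_one_mats I" by auto
    let ?N = "?g (w, T)"
    have "?N \<in> sym_mats ?J"
      using T w by (auto simp: row_sum_one_mats_def sym_mats_def vecs_def border_def algebra_simps)
    moreover have "(\<Sum>j\<in>?J. ?N i j) = 1" if "i \<in> ?J" for i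
    proof (cases "i = a")
      case True
      have "(\<Sum>j\<in>I. ?N a j) = (\<Sum>j\<in>I. w j)" by (intro sum.cong) (auto simp: border_def neq)
      then show ?thesis using True fin a by (simp add: border_def add.commute)
    next
      case False
      then have "(\<Sum>j\<in>I. ?N i j) = (\<Sum>j\<in>I. T i j + (w i + (w j + (\<Sum>k\<in>I. w k))))"
        using that by (intro sum.cong) (auto simp: border_def neq)
      also have "\<dots> = 1 + w i" unfolding sum_add_switch[OF od] using False that T
        by (simp add: row_sum_one_mats_def)
      finally show ?thesis using False that fin a by (simp add: border_def add.commute)
    qed
    ultimately show "?g p \<in> row_sum_one_mats ?J" unfolding p by (simp only: row_sum_one_mats_def) blast
  qed
  show "?g (?f N) = N" if N: "N \<in> row_sum_one_mats ?J" for N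
  proof -
    have "(\<Sum>k\<in>I. (if k \<in> I then N a k else 0)) = 1 + N a a"
      using row[OF N, of a] by (simp cong: sum.cong)
    then have "?g (?f N) i j = N i j" for i j
      using sym[OF N, of i a] out[OF N, of i j]
      by (cases "i = a"; cases "j = a"; cases "i \<in> I"; cases "j \<in> I")
         (simp_all add: border_def switch_block_def ac_simps a)
    then show ?thesis by blast
  qed
  show "?f (?g p) = p" if "p \<in> vecs I \<times> row_sum_one_mats I" for p
  proof -
    obtain w T where p: "p = (w, T)" "w \<in> vecs I" "T \<in> sym_mats I"
      using \<open>p \<in> _\<close> by (auto simp: row_sum_one_mats_def)
    then show ?thesis using sym_mats_outside[OF p(3)]
      by (auto simp: fun_eq_iff border_def switch_block_def neq vecs_def algebra_simps)
  qed
qed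

text \<open>Both conditions force the entries of \<open>y\<close> to sum to \<open>0\<close>: one by
  summing an odd number of equal entries, the other because the switched block has unit row sums.
  For such \<open>y\<close>, row \<open>i\<close> of the switched block gives the sum of rows
  \<open>i\<close> and \<open>a\<close> of \<open>M\<close> applied to \<open>y\<close>.\<close>

lemma card_mat_ker_switch_block:
  assumes fin: "finite I" and a: "a \<notin> I" and od: "odd (card I)" and M: "M \<in> row_sum_one_mats (insert a I)"
  shows "card (mat_ker (insert a I) M) = card (mat_ker I (switch_block a I M))"
proof -
  have sw: "switch_block a I M \<in> row_sum_one_mats I"
    using bij_betw_apply[OF bij_betw_switch_block[OF fin a od] M] by simp
  have "(\<forall>i\<in>I. dot I (M i) y = dot I (M a) y) \<longleftrightarrow> (\<forall>i\<in>I. dot I (switch_block a I M i) y = 0)"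
    if y: "y \<in> vecs I" for y
  proof -
    let ?s = "\<Sum>i\<in>I. y i"
    have sh: "dot I (switch_block a I M i) y = dot I (M i) y + dot I (M a) y + (M a i + M a a + 1) * ?s"
      if "i \<in> I" for i
    proof -
      have "dot I (switch_block a I M i) y = (\<Sum>j\<in>I. M i j * y j + M a j * y j + (M a i + M a a + 1) * y j)"
        unfolding dot_def using that by (intro sum.cong) (simp_all add: switch_block_def algebra_simps)
      then show ?thesis by (simp add: dot_def sum.distrib sum_distrib_left)
    qed
    have "y a = 0" using y a by (simp add: vecs_def)
    then have tot: "dot I (M a) y + (\<Sum>i\<in>I. dot I (M i) y) = ?s"
      using sum_dot_row_sum_one[OF M, of y] fin a by (simp add: dot_insert)
    show ?thesis
    proof
      assume eq: "\<forall>i\<in>I. dot I (M i) y = dot I (M a) y"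
      then have "(\<Sum>i\<in>I. dot I (M i) y) = (\<Sum>i\<in>I. dot I (M a) y)" by (intro sum.cong) simp_all
      also have "\<dots> = dot I (M a) y" unfolding sum_const_bit using od by simp
      finally have "?s = 0" using tot by simp
      with eq sh show "\<forall>i\<in>I. dot I (switch_block a I M i) y = 0" by simp
    next
      assume eq: "\<forall>i\<in>I. dot I (switch_block a I M i) y = 0"
      then have "?s = 0" using sum_dot_row_sum_one[OF sw, of y] by simp
      with eq sh show "\<forall>i\<in>I. dot I (M i) y = dot I (M a) y" by (simp add: bit_add_eq_0_iff)
    qed
  qed
  then show ?thesis
    unfolding card_mat_ker_row_sum_one[OF fin a M] by (intro arg_cong[where f = card] set_eqI) (simp add: mat_ker_iff cong: conj_cong)
qed

section \<open>Transfer of the kernel counts along the two bijections\<close>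

definition ker_card_count :: "'a set \<Rightarrow> nat \<Rightarrow> nat" where
  "ker_card_count V x = card {M \<in> row_sum_one_mats V. card (mat_ker V M) = x}"

lemma ker_card_count_insert_even:
  assumes "finite I" "a \<notin> I" "even (card I)"
  shows "ker_card_count (insert a I) x = card {T \<in> sym_mats I. card (mat_ker I T) = x}"
proof -
  have "{M \<in> row_sum_one_mats (insert a I). card (mat_ker I (shift_block I M)) = x} =
      {M \<in> row_sum_one_mats (insert a I). card (mat_ker (insert a I) M) = x}"
    using card_mat_ker_shift_block[OF assms] by auto
  then show ?thesis
    using bij_betw_same_card[OF bij_betw_restrict[OF bij_betw_shift_block[OF assms], of "\<lambda>T. card (mat_ker I T) = x"]]
    by (simp add: ker_card_count_def)
qed

lemma ker_card_count_insert_odd: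
  assumes "finite I" "a \<notin> I" "odd (card I)"
  shows "ker_card_count (insert a I) x = 2 ^ card I * ker_card_count I x"
proof -
  have "{M \<in> row_sum_one_mats (insert a I). card (mat_ker I (switch_block a I M)) = x} =
      {M \<in> row_sum_one_mats (insert a I). card (mat_ker (insert a I) M) = x}"
    using card_mat_ker_switch_block[OF assms] by auto
  moreover have "{p \<in> vecs I \<times> row_sum_one_mats I. card (mat_ker I (snd p)) = x} =
      vecs I \<times> {T \<in> row_sum_one_mats I. card (mat_ker I T) = x}" by auto
  ultimately show ?thesis
    using bij_betw_same_card[OF bij_betw_restrict[OF bij_betw_switch_block[OF assms], of "\<lambda>p. card (mat_ker I (snd p)) = x"]]
      card_vecs[OF assms(1)]
    by (simp add: ker_card_count_def card_cartesian_product)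
qed

subsection \<open>Graphs\<close>

text \<open>The vertex \<open>i\<close> need not lie in \<open>A\<close>, so that products of matrix
  rows with indicator vectors can be expressed too.\<close>

definition nbr_parity :: "'a set set \<Rightarrow> 'a set \<Rightarrow> 'a \<Rightarrow> bit" where
  "nbr_parity E A i = (\<Sum>j\<in>A - {i}. of_bool ({i, j} \<in> E))"

lemma of_nat_vertex_degree_induced:
  assumes "finite V" "E \<subseteq> vertex_pairs V" "A \<subseteq> V" "v \<in> A"
  shows "of_nat (vertex_degree (induced_edges E A) v) = nbr_parity E A v"
proof -
  have "bij_betw (\<lambda>u. {v, u}) {u \<in> A - {v}. {v, u} \<in> E} {e \<in> induced_edges E A. v \<in> e}"
    unfolding bij_betw_def
  proof
    show "inj_on (\<lambda>u. {v, u}) {u \<in> A - {v}. {v, u} \<in> E}" by (auto simp: inj_on_def doubleton_eq_iff)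
    show "(\<lambda>u. {v, u}) ` {u \<in> A - {v}. {v, u} \<in> E} = {e \<in> induced_edges E A. v \<in> e}"
    proof (intro equalityI subsetI)
      fix e assume e: "e \<in> {e \<in> induced_edges E A. v \<in> e}"
      then have "card e = 2" using assms(2) by (auto simp: induced_edges_def vertex_pairs_def)
      then obtain u where "e = {v, u}" "u \<noteq> v" using e by (auto simp: card_2_iff)
      then show "e \<in> (\<lambda>u. {v, u}) ` {u \<in> A - {v}. {v, u} \<in> E}" using e by (auto simp: induced_edges_def)
    qed (use assms in \<open>auto simp: induced_edges_def\<close>)
  qed
  then have "vertex_degree (induced_edges E A) v = card {u \<in> A - {v}. {v, u} \<in> E}"
    by (simp add: vertex_degree_def bij_betw_same_card)
  moreover have "finite (A - {v})" using assms finite_subset by blast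
  ultimately show ?thesis by (simp add: nbr_parity_def of_bool_def sum.If_cases Int_def)
qed

definition graph_mat :: "'a set \<Rightarrow> 'a set set \<Rightarrow> 'a \<Rightarrow> 'a \<Rightarrow> bit" where
  "graph_mat V E i j = (if i \<in> V \<and> j \<in> V then if i = j then 1 + nbr_parity E V i else of_bool ({i, j} \<in> E) else 0)"

lemma graph_mat_in_row_sum_one_mats:
  assumes "finite V"
  shows "graph_mat V E \<in> row_sum_one_mats V"
proof -
  have "(\<Sum>j\<in>V. graph_mat V E i j) = 1" if "i \<in> V" for i
  proof -
    have "(\<Sum>j\<in>V - {i}. graph_mat V E i j) = nbr_parity E V i"
      unfolding nbr_parity_def using that by (intro sum.cong) (auto simp: graph_mat_def)
    then show ?thesis
      using assms that by (simp add: sum.remove[of V i] graph_mat_def add.assoc)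
  qed
  then show ?thesis
    by (auto simp: row_sum_one_mats_def sym_mats_def graph_mat_def insert_commute)
qed

text \<open>The off-diagonal entries are the graph, and the unit row sums force the
  diagonal.\<close>

lemma bij_betw_graph_mat:
  assumes "finite V"
  shows "bij_betw (graph_mat V) (Pow (vertex_pairs V)) (row_sum_one_mats V)"
proof (rule bij_betwI[where g = "\<lambda>M. {e \<in> vertex_pairs V. \<exists>i j. e = {i, j} \<and> M i j = 1}"])
  let ?g = "\<lambda>M :: 'a \<Rightarrow> 'a \<Rightarrow> bit. {e \<in> vertex_pairs V. \<exists>i j. e = {i, j} \<and> M i j = 1}"
  show "graph_mat V \<in> Pow (vertex_pairs V) \<rightarrow> row_sum_one_mats V"
    using graph_mat_in_row_sum_one_mats[OF assms] by blast
  show "?g \<in> row_sum_one_mats V \<rightarrow> Pow (vertex_pairs V)" by auto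
  show "?g (graph_mat V E) = E" if "E \<in> Pow (vertex_pairs V)" for E
  proof (intro equalityI subsetI)
    fix e assume "e \<in> ?g (graph_mat V E)"
    then obtain i j where "e = {i, j}" "graph_mat V E i j = 1" "card e = 2"
      by (auto simp: vertex_pairs_def)
    then show "e \<in> E" by (auto simp: graph_mat_def split: if_splits)
  next
    fix e assume "e \<in> E"
    then have "e \<in> vertex_pairs V" using that by auto
    then obtain i j where "e = {i, j}" "i \<noteq> j" "i \<in> V" "j \<in> V"
      by (auto simp: vertex_pairs_def card_2_iff)
    with \<open>e \<in> E\<close> have "e = {i, j}" "graph_mat V E i j = 1" by (auto simp: graph_mat_def)
    then show "e \<in> ?g (graph_mat V E)" using \<open>e \<in> vertex_pairs V\<close> by auto
  qed
  show "graph_mat V (?g M) = M" if M: "M \<in> row_sum_one_mats V" for M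
  proof (intro ext)
    fix i j
    have sym: "M i j = M j i" for i j using M by (auto simp: row_sum_one_mats_def sym_mats_def)
    have off: "of_bool ({i, j} \<in> ?g M) = M i j" if "i \<in> V" "j \<in> V" "i \<noteq> j" for i j
    proof -
      have "{i, j} \<in> ?g M \<longleftrightarrow> M i j = 1"
        using that sym[of i j] by (auto simp: vertex_pairs_def doubleton_eq_iff)
      then show ?thesis by (cases "M i j") auto
    qed
    show "graph_mat V (?g M) i j = M i j"
    proof (cases "i \<in> V \<and> j = i")
      case True
      then have "nbr_parity (?g M) V i = (\<Sum>j\<in>V - {i}. M i j)"
        unfolding nbr_parity_def by (intro sum.cong off) auto
      moreover have "M i i + (\<Sum>j\<in>V - {i}. M i j) = 1"
        using M True assms by (simp add: row_sum_one_mats_def sum.remove[of V i, symmetric])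
      ultimately have "1 + nbr_parity (?g M) V i = M i i" by (metis add.commute bit_add_self(2))
      then show ?thesis using True by (simp add: graph_mat_def)
    next
      case False
      show ?thesis
      proof (cases "i \<in> V \<and> j \<in> V")
        case True
        then show ?thesis using False off[of i j] by (auto simp: graph_mat_def)
      next
        case False
        then have "M i j = 0" using M sym[of i j] by (auto simp: row_sum_one_mats_def sym_mats_def)
        then show ?thesis using False by (auto simp: graph_mat_def)
      qed
    qed
  qed
qed

text \<open>Row \<open>i\<close> of the equation is compared with the splitting of the degree of
  \<open>i\<close> into its parts in \<open>A\<close> and \<open>V - A\<close>. For \<open>i\<close>
  in \<open>A\<close> it says that the part in \<open>A\<close> is even; for other \<open>i\<close>,
  that the part in \<open>V - A\<close> is odd.\<close>

lemma even_odd_iff_mat_vec: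
  assumes fin: "finite V" and E: "E \<subseteq> vertex_pairs V" and A: "A \<subseteq> V"
  shows "induces_all_even E A \<and> induces_all_odd E (V - A) \<longleftrightarrow>
    mat_vec V (graph_mat V E) (\<lambda>i. of_bool (i \<in> A)) = (\<lambda>i. graph_mat V E i i)"
proof -
  let ?M = "graph_mat V E" and ?x = "\<lambda>i. of_bool (i \<in> A) :: bit"
  have dot: "dot V (?M i) ?x = of_bool (i \<in> A) * (1 + nbr_parity E V i) + nbr_parity E A i" if "i \<in> V" for i
  proof -
    have "(\<Sum>j\<in>V - {i}. ?M i j * ?x j) = (\<Sum>j\<in>A - {i}. of_bool ({i, j} \<in> E))"
      using that fin A by (intro sum.mono_neutral_cong_right) (auto simp: graph_mat_def)
    moreover have "dot V (?M i) ?x = ?M i i * ?x i + (\<Sum>j\<in>V - {i}. ?M i j * ?x j)"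
      unfolding dot_def using fin that by (rule sum.remove)
    moreover have "?M i i = 1 + nbr_parity E V i" using that by (simp add: graph_mat_def)
    ultimately show ?thesis by (simp only: nbr_parity_def[of E A] mult.commute)
  qed
  have split: "nbr_parity E V i = nbr_parity E A i + nbr_parity E (V - A) i" for i
  proof -
    have "V - {i} = (A - {i}) \<union> (V - A - {i})" using A by auto
    moreover have "finite A" using A fin finite_subset by blast
    ultimately show ?thesis
      unfolding nbr_parity_def using fin by (simp only:) (intro sum.union_disjoint; auto)
  qed
  have ev: "even (vertex_degree (induced_edges E B) v) \<longleftrightarrow> nbr_parity E B v = 0"
    if "B \<subseteq> V" "v \<in> B" for B v
    using of_nat_vertex_degree_induced[OF fin E that] by (auto simp: of_nat_bit)
  have "mat_vec V ?M ?x = (\<lambda>i. ?M i i) \<longleftrightarrow> (\<forall>i\<in>V. dot V (?M i) ?x = 1 + nbr_parity E V i)"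
    by (subst mat_vec_eq_iff) (auto simp: vecs_def graph_mat_def)
  also have "\<dots> \<longleftrightarrow> (\<forall>i\<in>V. if i \<in> A then nbr_parity E A i = 0 else nbr_parity E (V - A) i = 1)"
  proof (intro ball_cong refl)
    fix i assume "i \<in> V"
    then show "dot V (?M i) ?x = 1 + nbr_parity E V i \<longleftrightarrow>
        (if i \<in> A then nbr_parity E A i = 0 else nbr_parity E (V - A) i = 1)"
      unfolding dot[OF \<open>i \<in> V\<close>] split[of i]
      by (cases "nbr_parity E A i"; cases "nbr_parity E (V - A) i") auto
  qed
  also have "\<dots> \<longleftrightarrow> induces_all_even E A \<and> induces_all_odd E (V - A)"
    unfolding induces_all_even_def induces_all_odd_def using A ev[OF A] ev[of "V - A"] by auto
  finally show ?thesis by simp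
qed

text \<open>A partition is identified with its even side, whose indicator solves an inhomogeneous
  linear system. The solutions form a coset of the kernel.\<close>

lemma card_even_odd_partitions:
  assumes fin: "finite V" and ne: "V \<noteq> {}" and E: "E \<subseteq> vertex_pairs V"
  shows "card (even_odd_partitions V E) = card (mat_ker V (graph_mat V E))"
proof -
  let ?M = "graph_mat V E"
  let ?P = "{A. A \<subseteq> V \<and> induces_all_even E A \<and> induces_all_odd E (V - A)}"
  let ?S = "{x \<in> vecs V. mat_vec V ?M x = (\<lambda>i. ?M i i)}"
  have "bij_betw (\<lambda>A. {A, V - A}) ?P (even_odd_partitions V E)"
    unfolding bij_betw_def
  proof
    show "inj_on (\<lambda>A. {A, V - A}) ?P"
    proof (rule inj_onI)
      fix A B assume A: "A \<in> ?P" and B: "B \<in> ?P" and eq: "{A, V - A} = {B, V - B}"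
      show "A = B"
      proof (rule ccontr)
        assume "A \<noteq> B"
        then have "B = V - A" "A = V - B" using eq by (auto simp: doubleton_eq_iff)
        \<comment> \<open>If either side could serve as the even one, every degree on both sides
          would be both even and odd.\<close>
        then have "A = {}" "B = {}"
          using A B by (auto simp: induces_all_even_def induces_all_odd_def)
        then show False using \<open>A \<noteq> B\<close> by simp
      qed
    qed
    show "(\<lambda>A. {A, V - A}) ` ?P = even_odd_partitions V E"
    proof (intro equalityI subsetI)
      fix p assume "p \<in> even_odd_partitions V E"
      then obtain A B where p: "p = {A, B}" "A \<union> B = V" "A \<inter> B = {}" and
        AB: "induces_all_even E A \<and> induces_all_odd E B \<or> induces_all_odd E A \<and> induces_all_even E B"
        unfolding even_odd_partitions_def by blast
      have "B = V - A" "A = V - B" "A \<subseteq> V" "B \<subseteq> V" using p by auto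
      then show "p \<in> (\<lambda>A. {A, V - A}) ` ?P" using AB p(1) by (metis (mono_tags, lifting) image_eqI insert_commute mem_Collect_eq)
    next
      fix p assume "p \<in> (\<lambda>A. {A, V - A}) ` ?P"
      then obtain A where "p = {A, V - A}" "A \<union> (V - A) = V" "A \<inter> (V - A) = {}"
        "induces_all_even E A \<and> induces_all_odd E (V - A)" by auto
      then show "p \<in> even_odd_partitions V E" unfolding even_odd_partitions_def by blast
    qed
  qed
  then have "card (even_odd_partitions V E) = card ?P" by (rule bij_betw_same_card[symmetric])
  also have "card ?P = card ?S"
  proof (rule bij_betw_same_card)
    show "bij_betw (\<lambda>A i. of_bool (i \<in> A)) ?P ?S"
  proof (rule bij_betwI[where g = "\<lambda>x. {i. x i = 1}"])
    show "(\<lambda>A i. of_bool (i \<in> A)) \<in> ?P \<rightarrow> ?S"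
      using even_odd_iff_mat_vec[OF fin E] by (auto simp: vecs_def)
    show "(\<lambda>x. {i. x i = 1}) \<in> ?S \<rightarrow> ?P"
    proof
      fix x :: "'a \<Rightarrow> bit" assume x: "x \<in> ?S"
      have "(\<lambda>i. of_bool (i \<in> {i. x i = 1})) = x" by (auto simp: fun_eq_iff of_bool_def)
      moreover have "{i. x i = 1} \<subseteq> V" using x by (force simp: vecs_def)
      ultimately show "{i. x i = 1} \<in> ?P" using even_odd_iff_mat_vec[OF fin E, of "{i. x i = 1}"] x by simp
    qed
  qed (auto simp: fun_eq_iff of_bool_def)
  qed
  also have "card ?S = card (mat_ker V ?M)"
  proof -
    have "?M \<in> sym_mats V" using graph_mat_in_row_sum_one_mats[OF fin] by (simp add: row_sum_one_mats_def)
    \<comment> \<open>Solvability of the system is the membership of the diagonal in the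
      range.\<close>
    then show ?thesis by (intro card_fiber_mat_vec diagonal_in_mat_range fin)
  qed
  finally show ?thesis .
qed

text \<open>At edge probability one half, the random graph is uniform on all sets of vertex pairs,
  so the probability is a quotient of counts.\<close>

lemma prob_Y_eq_conv_ker_card_count:
  assumes "n \<ge> 1"
  shows "prob_Y_eq n x = ker_card_count {1..n} x / 2 ^ (n choose 2)"
proof -
  let ?V = "{1..n}"
  have fin: "finite (vertex_pairs ?V)" by (rule finite_subset[of _ "Pow ?V"]) (auto simp: vertex_pairs_def)
  have card: "card (vertex_pairs ?V) = n choose 2"
    using n_subsets[of ?V 2] by (simp add: vertex_pairs_def)
  have "{E \<in> Pow (vertex_pairs ?V). card (mat_ker ?V (graph_mat ?V E)) = x} = {E \<in> Pow (vertex_pairs ?V). Y n E = x}"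
    using assms by (auto simp: Y_def card_even_odd_partitions)
  then have "card {E \<in> Pow (vertex_pairs ?V). Y n E = x} = ker_card_count ?V x"
    unfolding ker_card_count_def
    using bij_betw_same_card[OF bij_betw_restrict[OF bij_betw_graph_mat[of ?V], of "\<lambda>M. card (mat_ker ?V M) = x"]]
    by simp
  moreover have "binomial_random_graph n (1/2) = pmf_of_set (Pow (vertex_pairs ?V))"
    unfolding binomial_random_graph_def by (rule pmf_of_set_Pow_conv_bernoulli[OF fin])
  moreover have "measure_pmf.prob (pmf_of_set (Pow (vertex_pairs ?V))) {E. Y n E = x} =
      card (Pow (vertex_pairs ?V) \<inter> {E. Y n E = x}) / card (Pow (vertex_pairs ?V))"
    using fin by (intro measure_pmf_of_set) auto
  moreover have "Pow (vertex_pairs ?V) \<inter> {E. Y n E = x} = {E \<in> Pow (vertex_pairs ?V). Y n E = x}"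
    by auto
  ultimately show ?thesis
    unfolding prob_Y_eq_def using fin by (simp only: card_Pow card of_nat_power of_nat_numeral)
qed

theorem theorem5p4:
  fixes n :: nat
  assumes "n \<ge> 1"
  shows "(odd n \<longrightarrow>
           (\<forall>k\<le>n - 1.
              prob_Y_eq n (2 ^ k) =
                1 / 2 ^ (n choose 2) *
                (\<Prod>i = 1..(n - 1 - k) div 2. inverse (1 - 1 / 2 ^ (2 * i))) *
                (\<Prod>i = k + 1..n - 1. ((2::real) ^ i - 1))) \<and>
           (\<forall>x. (\<forall>k\<le>n - 1. x \<noteq> 2 ^ k) \<longrightarrow> prob_Y_eq n x = 0)) \<and>
         (even n \<longrightarrow> (\<forall>x. prob_Y_eq n x = prob_Y_eq (n - 1) x))"
proof -
  let ?I = "{1..n - 1}"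
  \<comment> \<open>Vertex \<open>n\<close> plays the role of the distinguished index
    \<open>a\<close>.\<close>
  have V: "{1..n} = insert n ?I" "n \<notin> ?I" using assms by auto
  show ?thesis
  proof (intro conjI impI allI)
    fix k assume "odd n" "k \<le> n - 1"
    then have "ker_card_count {1..n} (2 ^ k) = nullity_count ?I k"
      unfolding V(1) nullity_count_def using V(2) by (intro ker_card_count_insert_even) auto
    moreover have "real (nullity_count ?I k) = nullity_formula (n - 1) k"
      using nullity_count_eq[of ?I k] \<open>k \<le> n - 1\<close> by simp
    ultimately show "prob_Y_eq n (2 ^ k) =
        1 / 2 ^ (n choose 2) *
        (\<Prod>i = 1..(n - 1 - k) div 2. inverse (1 - 1 / 2 ^ (2 * i))) *
        (\<Prod>i = k + 1..n - 1. ((2::real) ^ i - 1))"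
      using assms by (simp add: prob_Y_eq_conv_ker_card_count nullity_formula_def)
  next
    fix x :: nat assume "odd n" and x: "\<forall>k\<le>n - 1. x \<noteq> 2 ^ k"
    have "card (mat_ker ?I T) \<noteq> x" for T using card_mat_ker_power2[of ?I T] x by force
    moreover have "ker_card_count {1..n} x = card {T \<in> sym_mats ?I. card (mat_ker ?I T) = x}"
      unfolding V(1) using V(2) \<open>odd n\<close> by (intro ker_card_count_insert_even) auto
    ultimately show "prob_Y_eq n x = 0"
      using assms by (simp add: prob_Y_eq_conv_ker_card_count)
  next
    fix x :: nat assume "even n"
    then have n: "n - 1 \<ge> 1" "odd (n - 1)" using assms by (auto elim!: evenE)
    then have "ker_card_count {1..n} x = 2 ^ (n - 1) * ker_card_count ?I x"
      unfolding V(1) using V(2) ker_card_count_insert_odd[of ?I n x] by simp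
    \<comment> \<open>The \<open>2 ^ (n - 1)\<close> choices of the row of vertex \<open>n\<close>
      cancel against the ratio of the numbers of graphs on \<open>n\<close> and on
      \<open>n - 1\<close> vertices.\<close>
    moreover have "n choose 2 = (n - 1) + (n - 1 choose 2)"
      using assms by (cases n) (simp_all add: numeral_2_eq_2)
    ultimately show "prob_Y_eq n x = prob_Y_eq (n - 1) x"
      unfolding prob_Y_eq_conv_ker_card_count[OF assms] prob_Y_eq_conv_ker_card_count[OF n(1)]
      by (simp only: power_add of_nat_mult of_nat_power) simp
  qed
qed

end
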